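(* Let $p$ be a prime, let $k \in \mathbb{N}$, let $\alpha_1,\ldots,\alpha_k \in \mathbb{N}_0$, let $A := \prod_{i=1}^k \mathbb{Z}_{p^{\alpha_i}}$, let $B$ be an abelian group of exponent $p$, and let $\delta(A,\mathbb{Z}_p) = \sum_{i=1}^k (p^{\alpha_i} - 1)$. Let $f_1,\ldots,f_r : A \to B$ be functions. If $$\delta(A,\mathbb{Z}_p) > \sum_{i=1}^r (|\operatorname{Range}(f_i)| - 1)\, \operatorname{Fdeg}(f_i),$$ then $p$ divides $|V(f_1,\ldots,f_r)|$, where $V(f_1,\ldots,f_r) := \{a \in A \mid f_1(a) = \cdots = f_r(a) = 0\}$.
   Context: $\mathbb{N}$ is the set of positive integers, $\mathbb{N}_0 = \mathbb{N} \cup \{0\}$; abelian groups are written additively, $\mathbb{Z}_n$ is the cyclic group of order $n$, and $\operatorname{Range}(f)$ is the image of $f$. For an abelian group $A$, $\mathbb{Z}[A]$ is the integral group ring; its elements are written as finite sums $\sum_{a\in A} z_a \tau_a$ with $z_a \in \mathbb{Z}$, and $\tau_a \cdot \tau_b = \tau_{a+b}$. The augmentation ideal $\operatorname{Aug}(\mathbb{Z}[A])$ is the ideal of $\mathbb{Z}[A]$ generated by $\{\tau_a - 1 \mid a \in A\}$. For an ideal $I$, $I^0 = \mathbb{Z}[A]$ and $I^n$ is the ideal generated by all products $i_1\cdots i_n$ with $i_1,\ldots,i_n \in I$. For an abelian group $B$, the ring $\mathbb{Z}[A]$ acts on the group $B^A$ of all functions $f : A \to B$ by $((\sum_{a} z_a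 \tau_a) * f)(x) = \sum_{a} z_a f(x+a)$. For an ideal $J$, $J * f = 0$ means $j * f = 0$ for all $j \in J$. Functional degree: for a function $f : A \to B$ between abelian groups and $I := \operatorname{Aug}(\mathbb{Z}[A])$, $\operatorname{Fdeg}(f) := \min\{ n \in \mathbb{N}_0 \mid I^{n+1} * f = 0\}$, with $\operatorname{Fdeg}(f) = \infty$ if no such $n$ exists. *)

theory Defs
  imports
    "HOL-Library.Poly_Mapping"
    "HOL-Library.Extended_Nat"
    "HOL-Algebra.Algebra"
    "HOL-Computational_Algebra.Primes"
begin

text \<open>Groups of the library HOL-Algebra are written multiplicatively; so the zero of an abelian
  group \<open>B\<close> is \<open>\<one>\<^bsub>B\<^esub>\<close>, and \<open>z b\<close> for an integer \<open>z\<close> is \<open>b [^]\<^bsub>B\<^esub> z\<close>.\<close>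

text \<open>The exponent is 0 if no positive integer annihilates the group.\<close>

definition group_exponent :: "('b, 'm) monoid_scheme \<Rightarrow> nat"
  where "group_exponent B =
    (if \<exists>n::nat. n > 0 \<and> (\<forall>b\<in>carrier B. b [^]\<^bsub>B\<^esub> n = \<one>\<^bsub>B\<^esub>)
     then LEAST n::nat. n > 0 \<and> (\<forall>b\<in>carrier B. b [^]\<^bsub>B\<^esub> n = \<one>\<^bsub>B\<^esub>)
     else 0)"


section \<open>The integral group ring\<close>

text \<open>An element is a finitely supported integer-valued function whose support lies in \<open>A\<close>. The
  basis element \<open>\<tau>\<^sub>a\<close> is \<^term>\<open>frag_of a\<close>, and the product is the bilinear extension of
  \<open>\<tau>\<^sub>a \<tau>\<^sub>b = \<tau>\<^sub>a\<^sub>+\<^sub>b\<close>.\<close>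

definition group_ring :: "('a, 'm) monoid_scheme \<Rightarrow> ('a \<Rightarrow>\<^sub>0 int) ring"
  where "group_ring A =
    \<lparr>carrier = {u. Poly_Mapping.keys u \<subseteq> carrier A},
     monoid.mult = (\<lambda>u v. frag_extend (\<lambda>a. frag_extend (\<lambda>b. frag_of (a \<otimes>\<^bsub>A\<^esub> b)) v) u),
     one = frag_of \<one>\<^bsub>A\<^esub>,
     ring.zero = 0,
     ring.add = (+)\<rparr>"

definition augmentation_ideal :: "('a, 'm) monoid_scheme \<Rightarrow> ('a \<Rightarrow>\<^sub>0 int) set"
  where "augmentation_ideal A =
    genideal (group_ring A) {frag_of a - frag_of \<one>\<^bsub>A\<^esub> | a. a \<in> carrier A}"

text \<open>For \<open>n = 0\<close> the only product is the empty one, which generates the whole ring.\<close>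

definition ideal_power :: "('r, 'm) ring_scheme \<Rightarrow> 'r set \<Rightarrow> nat \<Rightarrow> 'r set"
  where "ideal_power R J n =
    genideal R {\<Otimes>\<^bsub>R\<^esub>i\<in>{..<n}. x i | x. x \<in> {..<n} \<rightarrow> J}"

definition ring_act ::
    "('a, 'm) monoid_scheme \<Rightarrow> ('b, 'n) monoid_scheme \<Rightarrow> ('a \<Rightarrow>\<^sub>0 int) \<Rightarrow> ('a \<Rightarrow> 'b) \<Rightarrow> 'a \<Rightarrow> 'b"
  where "ring_act A B u f x =
    (\<Otimes>\<^bsub>B\<^esub>a\<in>Poly_Mapping.keys u. f (x \<otimes>\<^bsub>A\<^esub> a) [^]\<^bsub>B\<^esub> Poly_Mapping.lookup u a)"

definition annihilates ::
    "('a, 'm) monoid_scheme \<Rightarrow> ('b, 'n) monoid_scheme \<Rightarrow> ('a \<Rightarrow>\<^sub>0 int) set \<Rightarrow> ('a \<Rightarrow> 'b) \<Rightarrow> bool"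
  where "annihilates A B J f \<longleftrightarrow> (\<forall>u\<in>J. \<forall>x\<in>carrier A. ring_act A B u f x = \<one>\<^bsub>B\<^esub>)"

text \<open>The infimum of the empty set of extended naturals is \<open>\<infinity>\<close>.\<close>

definition Fdeg :: "('a, 'm) monoid_scheme \<Rightarrow> ('b, 'n) monoid_scheme \<Rightarrow> ('a \<Rightarrow> 'b) \<Rightarrow> enat"
  where "Fdeg A B f =
    Inf {enat n | n. annihilates A B (ideal_power (group_ring A) (augmentation_ideal A) (n + 1)) f}"

definition common_zeros ::
    "('a, 'm) monoid_scheme \<Rightarrow> ('b, 'n) monoid_scheme \<Rightarrow> nat \<Rightarrow> (nat \<Rightarrow> 'a \<Rightarrow> 'b) \<Rightarrow> 'a set"
  where "common_zeros A B r f = {a \<in> carrier A. \<forall>i\<in>{1..r}. f i a = \<one>\<^bsub>B\<^esub>}"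


section \<open>The group ring is a commutative ring\<close>

lemma frag_extend_fun_diff:
  "frag_extend (\<lambda>a. g a - h a) u = frag_extend g u - frag_extend h u"
proof -
  have "frag_cmul c (x - y) = frag_cmul c x - frag_cmul c y" for c and x y :: "'a \<Rightarrow>\<^sub>0 int"
    by (rule poly_mapping_eqI) (simp add: lookup_minus right_diff_distrib)
  then show ?thesis
    by (simp add: frag_extend_def sum_subtractf)
qed

lemma frag_extend_fun_zero: "frag_extend (\<lambda>a. 0) u = 0"
  by (simp add: frag_extend_def)

lemma group_ring_simps:
  "carrier (group_ring A) = {u. Poly_Mapping.keys u \<subseteq> carrier A}"
  "u \<otimes>\<^bsub>group_ring A\<^esub> v = frag_extend (\<lambda>a. frag_extend (\<lambda>b. frag_of (a \<otimes>\<^bsub>A\<^esub> b)) v) u"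
  "\<one>\<^bsub>group_ring A\<^esub> = frag_of \<one>\<^bsub>A\<^esub>"
  "\<zero>\<^bsub>group_ring A\<^esub> = 0"
  "u \<oplus>\<^bsub>group_ring A\<^esub> v = u + v"
  by (simp_all add: group_ring_def)

lemma group_ring_mult_of:
  "frag_of a \<otimes>\<^bsub>group_ring A\<^esub> frag_of b = frag_of (a \<otimes>\<^bsub>A\<^esub> b)"
  by (simp add: group_ring_simps)

lemma group_ring_mult_bilinear:
  "0 \<otimes>\<^bsub>group_ring A\<^esub> v = 0"
  "v \<otimes>\<^bsub>group_ring A\<^esub> 0 = 0"
  "(u - u') \<otimes>\<^bsub>group_ring A\<^esub> v = u \<otimes>\<^bsub>group_ring A\<^esub> v - u' \<otimes>\<^bsub>group_ring A\<^esub> v"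
  "v \<otimes>\<^bsub>group_ring A\<^esub> (u - u') = v \<otimes>\<^bsub>group_ring A\<^esub> u - v \<otimes>\<^bsub>group_ring A\<^esub> u'"
  "(u + u') \<otimes>\<^bsub>group_ring A\<^esub> v = u \<otimes>\<^bsub>group_ring A\<^esub> v + u' \<otimes>\<^bsub>group_ring A\<^esub> v"
  by (simp_all add: group_ring_simps frag_extend_diff frag_extend_add frag_extend_fun_diff
        frag_extend_fun_zero)

lemma cring_group_ring:
  assumes "comm_group A"
  shows "cring (group_ring A)"
proof -
  interpret A: comm_group A by fact
  let ?R = "group_ring A"
  have closed: "Poly_Mapping.keys (u \<otimes>\<^bsub>?R\<^esub> v) \<subseteq> carrier A"
    if "Poly_Mapping.keys u \<subseteq> carrier A" "Poly_Mapping.keys v \<subseteq> carrier A" for u v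
  proof -
    have "Poly_Mapping.keys (frag_extend (\<lambda>b. frag_of (a \<otimes>\<^bsub>A\<^esub> b)) v) \<subseteq> carrier A"
      if "a \<in> carrier A" for a
      using keys_frag_extend[of "\<lambda>b. frag_of (a \<otimes>\<^bsub>A\<^esub> b)" v] that
        \<open>Poly_Mapping.keys v \<subseteq> carrier A\<close> by fastforce
    then show ?thesis
      using keys_frag_extend[of "\<lambda>a. frag_extend (\<lambda>b. frag_of (a \<otimes>\<^bsub>A\<^esub> b)) v" u] that
      unfolding group_ring_simps by blast
  qed
  have comm: "u \<otimes>\<^bsub>?R\<^esub> v = v \<otimes>\<^bsub>?R\<^esub> u"
    if "Poly_Mapping.keys u \<subseteq> carrier A" "Poly_Mapping.keys v \<subseteq> carrier A" for u v
    using that(1)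
  proof (induction u rule: frag_induction)
    case (one a)
    from that(2) show ?case
    proof (induction v rule: frag_induction)
      case (one b)
      then show ?case
        using \<open>a \<in> carrier A\<close> by (simp add: group_ring_mult_of A.m_comm)
    qed (simp_all add: group_ring_mult_bilinear)
  qed (simp_all add: group_ring_mult_bilinear)
  have assoc: "(u \<otimes>\<^bsub>?R\<^esub> v) \<otimes>\<^bsub>?R\<^esub> w = u \<otimes>\<^bsub>?R\<^esub> (v \<otimes>\<^bsub>?R\<^esub> w)"
    if "Poly_Mapping.keys u \<subseteq> carrier A" "Poly_Mapping.keys v \<subseteq> carrier A"
      "Poly_Mapping.keys w \<subseteq> carrier A" for u v w
    using that(1)
  proof (induction u rule: frag_induction)
    case (one a)
    from that(2) show ?case
    proof (induction v rule: frag_induction)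
      case (one b)
      from that(3) show ?case
      proof (induction w rule: frag_induction)
        case (one c)
        then show ?case
          using \<open>a \<in> carrier A\<close> \<open>b \<in> carrier A\<close> by (simp add: group_ring_mult_of A.m_assoc)
      qed (simp_all add: group_ring_mult_bilinear)
    qed (simp_all add: group_ring_mult_bilinear)
  qed (simp_all add: group_ring_mult_bilinear)
  have one: "frag_of \<one>\<^bsub>A\<^esub> \<otimes>\<^bsub>?R\<^esub> u = u" if "Poly_Mapping.keys u \<subseteq> carrier A" for u
    using that
  proof (induction u rule: frag_induction)
    case (one a)
    then show ?case by (simp add: group_ring_mult_of)
  qed (simp_all add: group_ring_mult_bilinear)
  show ?thesis
  proof (rule cringI)
    show "abelian_group ?R"
    proof (rule abelian_groupI)
      fix u v
      assume "u \<in> carrier ?R" "v \<in> carrier ?R"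
      then show "u \<oplus>\<^bsub>?R\<^esub> v \<in> carrier ?R"
        using Poly_Mapping.keys_add[of u v] by (auto simp: group_ring_simps)
    next
      fix u
      assume "u \<in> carrier ?R"
      then show "\<exists>v\<in>carrier ?R. v \<oplus>\<^bsub>?R\<^esub> u = \<zero>\<^bsub>?R\<^esub>"
        by (intro bexI[of _ "- u"]) (auto simp: group_ring_simps)
    qed (auto simp: group_ring_simps algebra_simps)
    show "comm_monoid ?R"
      by (rule comm_monoidI)
        (use closed comm assoc one in \<open>auto simp: group_ring_simps(1,3) keys_frag_of\<close>)
    fix u v w
    show "(u \<oplus>\<^bsub>?R\<^esub> v) \<otimes>\<^bsub>?R\<^esub> w = u \<otimes>\<^bsub>?R\<^esub> w \<oplus>\<^bsub>?R\<^esub> v \<otimes>\<^bsub>?R\<^esub> w"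
      by (simp add: group_ring_simps(5) group_ring_mult_bilinear)
  qed
qed

end

theory Submission
  imports Defs "HOL-Number_Theory.Cong"
begin

text \<open>A character \<open>B \<rightarrow> \<int>\<^sub>p\<close> that does not vanish at \<open>b\<close> turns \<open>f\<^sub>i\<close> into a function with values in
  \<open>\<int>\<^sub>p\<close>, of no larger functional degree, that separates \<open>b\<close> from 0. Multiplying such functions,
  one factor for every nonzero value of every \<open>f\<^sub>i\<close>, gives, up to a nonzero constant, the indicator
  function of the common zeros. Degrees are subadditive under products, so this indicator has degree
  less than \<open>\<delta>\<close>. Its sum over \<open>A\<close> vanishes in \<open>\<int>\<^sub>p\<close>, since modulo \<open>p\<close> the element
  \<open>\<Sum>\<^bsub>a\<in>A\<^esub> \<tau>\<^sub>a = \<Prod>\<^sub>i (t\<^sub>i - 1) ^ (p ^ \<alpha>\<^sub>i - 1)\<close>, where \<open>t\<^sub>i\<close> is the basis element of a generator of the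
  \<open>i\<close>-th factor, lies in the \<open>\<delta>\<close>-th power of the augmentation ideal.\<close>

section \<open>Functional degree modulo \<open>p\<close> by iterated differences\<close>

text \<open>\<open>deg_less G p n F\<close> means that the \<open>n\<close>-th power of the augmentation ideal annihilates \<open>F\<close>
  modulo \<open>p\<close>; so \<open>n\<close> is one more than a degree bound, and \<open>n = 0\<close> forces \<open>F\<close> to vanish.\<close>

primrec deg_less :: "('a, 'm) monoid_scheme \<Rightarrow> int \<Rightarrow> nat \<Rightarrow> ('a \<Rightarrow> int) \<Rightarrow> bool" where
  "deg_less G p 0 F \<longleftrightarrow> (\<forall>x\<in>carrier G. p dvd F x)"
| "deg_less G p (Suc n) F \<longleftrightarrow> (\<forall>a\<in>carrier G. deg_less G p n (\<lambda>x. F (x \<otimes>\<^bsub>G\<^esub> a) - F x))"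

context comm_group
begin

text \<open>Integer-valued functions stand for functions into the integers modulo \<open>p\<close>;
  this permits a change of representatives, and rewriting that is valid only on the carrier.\<close>

lemma deg_less_cong:
  assumes "\<And>x. x \<in> carrier G \<Longrightarrow> p dvd F x - F' x" "deg_less G p n F"
  shows "deg_less G p n F'"
  using assms
proof (induction n arbitrary: F F')
  case 0
  have "p dvd F' x" if "x \<in> carrier G" for x
    using dvd_diff[of p "F x" "F x - F' x"] 0 that by simp
  then show ?case
    by simp
next
  case (Suc n)
  show ?case
  proof (simp, intro ballI)
    fix a assume a: "a \<in> carrier G"
    show "deg_less G p n (\<lambda>x. F' (x \<otimes> a) - F' x)"
    proof (rule Suc.IH)
      show "deg_less G p n (\<lambda>x. F (x \<otimes> a) - F x)"
        using Suc.prems a by simp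
      fix x assume x: "x \<in> carrier G"
      have "p dvd (F (x \<otimes> a) - F' (x \<otimes> a)) - (F x - F' x)"
        by (rule dvd_diff) (use Suc.prems(1) a x in auto)
      then show "p dvd F (x \<otimes> a) - F x - (F' (x \<otimes> a) - F' x)"
        by (simp add: algebra_simps)
    qed
  qed
qed

lemma deg_less_zero:
  assumes "\<And>x. x \<in> carrier G \<Longrightarrow> p dvd F x"
  shows "deg_less G p n F"
proof -
  have "deg_less G p n (\<lambda>x. 0)"
    by (induction n) auto
  then show ?thesis
    by (rule deg_less_cong[rotated]) (use assms in auto)
qed

lemma deg_less_const: "deg_less G p (Suc 0) (\<lambda>x. c)"
  by simp

lemma deg_less_diff:
  assumes "deg_less G p n F" "deg_less G p n F'"
  shows "deg_less G p n (\<lambda>x. F x - F' x)"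
  using assms
proof (induction n arbitrary: F F')
  case (Suc n)
  show ?case
  proof (simp, intro ballI)
    fix a assume a: "a \<in> carrier G"
    have "deg_less G p n (\<lambda>x. (F (x \<otimes> a) - F x) - (F' (x \<otimes> a) - F' x))"
      by (rule Suc.IH) (use Suc.prems a in auto)
    then show "deg_less G p n (\<lambda>x. F (x \<otimes> a) - F' (x \<otimes> a) - (F x - F' x))"
      by (simp add: algebra_simps)
  qed
qed auto

lemma deg_less_add:
  assumes "deg_less G p n F" "deg_less G p n F'"
  shows "deg_less G p n (\<lambda>x. F x + F' x)"
proof -
  have "deg_less G p n (\<lambda>x. F x - (0 - F' x))"
    by (intro deg_less_diff assms deg_less_zero) auto
  then show ?thesis
    by simp
qed

text \<open>Translations commute with differences because the group is abelian. The Leibniz rule for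
  products needs this for its translated factor.\<close>

lemma deg_less_shift:
  assumes "deg_less G p n F" "b \<in> carrier G"
  shows "deg_less G p n (\<lambda>x. F (x \<otimes> b))"
  using assms(1)
proof (induction n arbitrary: F)
  case 0
  then show ?case
    using assms(2) by simp
next
  case (Suc n)
  show ?case
  proof (simp, intro ballI)
    fix a assume a: "a \<in> carrier G"
    have "deg_less G p n (\<lambda>x. F (x \<otimes> b \<otimes> a) - F (x \<otimes> b))"
      using Suc.prems a by (intro Suc.IH) auto
    then show "deg_less G p n (\<lambda>x. F (x \<otimes> a \<otimes> b) - F (x \<otimes> b))"
      by (rule deg_less_cong[rotated]) (use a assms(2) in \<open>simp add: m_ac\<close>)
  qed
qed

text \<open>A difference of \<open>F\<close> is a translate of \<open>F\<close> minus
  \<open>F\<close>, so it inherits every bound that \<open>F\<close> has.\<close>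

lemma deg_less_mono:
  assumes "deg_less G p m F" "m \<le> n"
  shows "deg_less G p n F"
  using assms(2)
proof (induction n rule: dec_induct)
  case (step n)
  then show ?case
    by (auto intro!: deg_less_diff deg_less_shift)
qed (rule assms(1))

text \<open>The induction rests on the Leibniz rule
  \<open>\<Delta>\<^sub>a (F F') (x) = \<Delta>\<^sub>a F (x) F' (x + a) + F (x) \<Delta>\<^sub>a F' (x)\<close>.\<close>

lemma deg_less_mult:
  assumes "deg_less G p m F" "deg_less G p n F'"
  shows "deg_less G p (m + n - 1) (\<lambda>x. F x * F' x)"
  using assms
proof (induction "m + n" arbitrary: m n F F' rule: less_induct)
  case less
  show ?case
  \<comment> \<open>If a bound is 0, that factor vanishes modulo \<open>p\<close>, hence so does the
    product. Otherwise \<open>m + n - 1\<close> is one more than the sum of the degree bounds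
    \<open>m - 1\<close> and \<open>n - 1\<close>.\<close>
  proof (cases "m = 0 \<or> n = 0")
    case True
    then show ?thesis
      using less.prems by (intro deg_less_zero) auto
  next
    case False
    then obtain m' n' where mn: "m = Suc m'" "n = Suc n'"
      by (metis not0_implies_Suc)
    have "deg_less G p (Suc (m' + n')) (\<lambda>x. F x * F' x)"
    proof (simp, intro ballI)
      fix a assume a: "a \<in> carrier G"
      have "deg_less G p (m' + n - 1) (\<lambda>x. (F (x \<otimes> a) - F x) * F' (x \<otimes> a))"
        using less.prems mn a by (intro less.hyps deg_less_shift) auto
      moreover have "deg_less G p (m + n' - 1) (\<lambda>x. F x * (F' (x \<otimes> a) - F' x))"
        using less.prems mn a by (intro less.hyps) auto
      ultimately have "deg_less G p (m' + n')
          (\<lambda>x. (F (x \<otimes> a) - F x) * F' (x \<otimes> a) + F x * (F' (x \<otimes> a) - F' x))"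
        using mn by (intro deg_less_add) auto
      then show "deg_less G p (m' + n') (\<lambda>x. F (x \<otimes> a) * F' (x \<otimes> a) - F x * F' x)"
        by (simp add: algebra_simps)
    qed
    then show ?thesis
      by (simp add: mn)
  qed
qed

text \<open>With the bounds written as successors, degrees simply add, and the empty product is the
  constant 1 of degree 0.\<close>

lemma deg_less_prod:
  assumes "finite S" "\<And>i. i \<in> S \<Longrightarrow> deg_less G p (Suc (d i)) (F i)"
  shows "deg_less G p (Suc (\<Sum>i\<in>S. d i)) (\<lambda>x. \<Prod>i\<in>S. F i x)"
  using assms
proof (induction S rule: finite_induct)
  case (insert i S)
  have "deg_less G p (Suc (d i) + Suc (\<Sum>i\<in>S. d i) - 1) (\<lambda>x. F i x * (\<Prod>i\<in>S. F i x))"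
    by (intro deg_less_mult insert) (use insert in auto)
  then show ?case
    using insert by simp
qed (simp add: deg_less_const)

end


section \<open>The action of the group ring modulo \<open>p\<close>\<close>

definition int_act :: "('a, 'm) monoid_scheme \<Rightarrow> ('a \<Rightarrow>\<^sub>0 int) \<Rightarrow> ('a \<Rightarrow> int) \<Rightarrow> 'a \<Rightarrow> int" where
  "int_act G u F x = (\<Sum>a\<in>Poly_Mapping.keys u. Poly_Mapping.lookup u a * F (x \<otimes>\<^bsub>G\<^esub> a))"

lemma int_act_superset:
  assumes "finite S" "Poly_Mapping.keys u \<subseteq> S"
  shows "int_act G u F x = (\<Sum>a\<in>S. Poly_Mapping.lookup u a * F (x \<otimes>\<^bsub>G\<^esub> a))"
  unfolding int_act_def using assms by (intro sum.mono_neutral_left) (auto simp: in_keys_iff)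

lemma int_act_diff: "int_act G (u - v) F x = int_act G u F x - int_act G v F x"
proof -
  let ?S = "Poly_Mapping.keys u \<union> Poly_Mapping.keys v"
  have "Poly_Mapping.keys (u - v) \<subseteq> ?S"
    by (rule keys_diff)
  then show ?thesis
    by (simp add: int_act_superset[of ?S] lookup_minus left_diff_distrib sum_subtractf)
qed

lemma int_act_frag_of: "int_act G (frag_of a) F x = F (x \<otimes>\<^bsub>G\<^esub> a)"
  by (simp add: int_act_def)

lemma int_act_zero: "int_act G 0 F x = 0"
  by (simp add: int_act_def)

context comm_group
begin

text \<open>Both sides are additive in \<open>u\<close>, so basis elements suffice. The factor
  \<open>\<tau>\<^sub>b - 1\<close> is thereby absorbed into \<open>F\<close> as a difference, which
  links the group ring to \<open>deg_less\<close>.\<close>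

lemma int_act_difference:
  assumes "b \<in> carrier G" "x \<in> carrier G" "Poly_Mapping.keys u \<subseteq> carrier G"
  shows "int_act G ((frag_of b - frag_of \<one>) \<otimes>\<^bsub>group_ring G\<^esub> u) F x =
    int_act G u (\<lambda>x. F (x \<otimes> b) - F x) x"
  using assms(3)
proof (induction u rule: frag_induction)
  case (one c)
  then show ?case
    using assms by (simp add: group_ring_mult_bilinear group_ring_mult_of int_act_diff
        int_act_frag_of m_ac)
qed (simp_all add: group_ring_mult_bilinear int_act_diff int_act_zero)

text \<open>Acting by a product of \<open>n\<close> generators of the augmentation ideal is the same
  as taking \<open>n\<close> successive differences, so only these products have to be
  tested.\<close>

lemma deg_less_if_int_act:
  assumes "\<And>a x. a \<in> {..<n} \<rightarrow> carrier G \<Longrightarrow> x \<in> carrier G \<Longrightarrow>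
    p dvd int_act G (\<Otimes>\<^bsub>group_ring G\<^esub>i\<in>{..<n}. frag_of (a i) - frag_of \<one>) F x"
  shows "deg_less G p n F"
  using assms
proof (induction n arbitrary: F)
  case 0
  show ?case
    \<comment> \<open>The empty product is the unit of the group ring, which fixes \<open>F\<close>;
      no direction enters it.\<close>
    using 0[of "\<lambda>_. \<one>"]
    by (auto simp: finprod_def group_ring_simps int_act_frag_of)
next
  case (Suc n)
  interpret R: cring "group_ring G"
    by (rule cring_group_ring) (rule comm_group_axioms)
  have D: "frag_of c - frag_of \<one> \<in> carrier (group_ring G)" if "c \<in> carrier G" for c
    using that keys_diff[of "frag_of c" "frag_of \<one>"] by (auto simp: group_ring_simps)
  show ?case
  proof (simp, intro ballI, rule Suc.IH)
    fix b a x
    assume b: "b \<in> carrier G" and a: "a \<in> {..<n} \<rightarrow> carrier G" and x: "x \<in> carrier G"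
    \<comment> \<open>The new direction gets the free index \<open>n\<close>, so the first
      \<open>n\<close> factors are unchanged.\<close>
    let ?a = "a(n := b)"
    let ?P = "\<Otimes>\<^bsub>group_ring G\<^esub>i\<in>{..<n}. frag_of (a i) - frag_of \<one>"
    have P: "?P \<in> carrier (group_ring G)"
      by (rule R.finprod_closed) (use D a in auto)
    have "(\<Otimes>\<^bsub>group_ring G\<^esub>i\<in>{..<Suc n}. frag_of (?a i) - frag_of \<one>) =
        (frag_of b - frag_of \<one>) \<otimes>\<^bsub>group_ring G\<^esub>
        (\<Otimes>\<^bsub>group_ring G\<^esub>i\<in>{..<n}. frag_of (?a i) - frag_of \<one>)"
      unfolding lessThan_Suc using b D funcset_mem[OF a] by (subst R.finprod_insert) auto
    also have "(\<Otimes>\<^bsub>group_ring G\<^esub>i\<in>{..<n}. frag_of (?a i) - frag_of \<one>) = ?P"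
      by (rule R.finprod_cong') (use D funcset_mem[OF a] in auto)
    finally have "int_act G ?P (\<lambda>x. F (x \<otimes> b) - F x) x =
        int_act G (\<Otimes>\<^bsub>group_ring G\<^esub>i\<in>{..<Suc n}. frag_of (?a i) - frag_of \<one>) F x"
      using P b x by (simp add: int_act_difference group_ring_simps(1))
    moreover have "p dvd \<dots>"
      using a b x by (intro Suc.prems) (auto simp: Pi_iff less_Suc_eq)
    ultimately show "p dvd int_act G ?P (\<lambda>x. F (x \<otimes> b) - F x) x"
      by simp
  qed
qed

end


section \<open>Characters modulo \<open>p\<close>\<close>

text \<open>Homomorphisms into the integers modulo \<open>p\<close> are given by integer
  representatives, so that their values can be multiplied and summed with plain integer
  arithmetic.\<close>

definition character_mod :: "('b, 'm) monoid_scheme \<Rightarrow> int \<Rightarrow> ('b \<Rightarrow> int) \<Rightarrow> bool" where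
  "character_mod B p h \<longleftrightarrow>
    (\<forall>x\<in>carrier B. \<forall>y\<in>carrier B. [h (x \<otimes>\<^bsub>B\<^esub> y) = h x + h y] (mod p))"

context comm_group
begin

context
  fixes p :: int and h :: "'a \<Rightarrow> int"
  assumes h: "character_mod G p h"
begin

lemma character_mult:
  "x \<in> carrier G \<Longrightarrow> y \<in> carrier G \<Longrightarrow> [h (x \<otimes> y) = h x + h y] (mod p)"
  using h by (auto simp: character_mod_def)

lemma character_one: "[h \<one> = 0] (mod p)"
proof -
  have "[h \<one> = h \<one> + h \<one>] (mod p)"
    using character_mult[of \<one> \<one>] by simp
  then show ?thesis
    by (metis add_0 cong_add_rcancel cong_sym)
qed

lemma character_nat_pow:
  assumes "x \<in> carrier G"
  shows "[h (x [^] (n::nat)) = int n * h x] (mod p)"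
proof (induction n)
  case (Suc n)
  have "[h (x [^] n \<otimes> x) = h (x [^] n) + h x] (mod p)"
    using assms by (intro character_mult) auto
  also have "[h (x [^] n) + h x = int n * h x + h x] (mod p)"
    using Suc by (intro cong_add) auto
  finally show ?case
    by (simp add: algebra_simps)
qed (simp add: character_one)

lemma character_inv:
  assumes "x \<in> carrier G"
  shows "[h (inv x) = - h x] (mod p)"
proof -
  have "[h x + h (inv x) = h \<one>] (mod p)"
    using character_mult[of x "inv x"] assms by (simp add: cong_sym)
  then have "[h x + h (inv x) = h x + - h x] (mod p)"
    using character_one cong_trans by fastforce
  then show ?thesis
    by (simp only: cong_add_lcancel)
qed

lemma character_int_pow:
  assumes "x \<in> carrier G"
  shows "[h (x [^] (z::int)) = z * h x] (mod p)"
proof (cases "z \<ge> 0")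
  case True
  then show ?thesis
    using character_nat_pow[OF assms, of "nat z"] by (simp add: int_pow_def nat_pow_def)
next
  case False
  have "x [^] z = inv (x [^] nat (- z))"
    using False by (subst int_pow_def2) simp
  then have "[h (x [^] z) = - h (x [^] nat (- z))] (mod p)"
    using assms by (simp only: character_inv nat_pow_closed)
  also have "[- h (x [^] nat (- z)) = - (int (nat (- z)) * h x)] (mod p)"
    using character_nat_pow[OF assms] by (simp only: cong_minus_minus_iff)
  finally show ?thesis
    using False by simp
qed

lemma character_finprod:
  assumes "finite S" "g \<in> S \<rightarrow> carrier G"
  shows "[h (\<Otimes>i\<in>S. g i) = (\<Sum>i\<in>S. h (g i))] (mod p)"
  using assms
proof (induction S rule: finite_induct)
  case (insert i S)
  have "[h (g i \<otimes> (\<Otimes>i\<in>S. g i)) = h (g i) + h (\<Otimes>i\<in>S. g i)] (mod p)"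
    using insert.prems by (intro character_mult) auto
  also have "[h (g i) + h (\<Otimes>i\<in>S. g i) = h (g i) + (\<Sum>i\<in>S. h (g i))] (mod p)"
    using insert by (intro cong_add) auto
  finally show ?case
    using insert by (simp add: Pi_iff)
qed (simp add: character_one)

end

text \<open>This is the subgroup generated by \<open>M\<close> and \<open>x\<close>. Its explicit
  form turns membership of \<open>b\<close> into a relation between \<open>b\<close> and a power of
  \<open>x\<close>.\<close>

lemma subgroup_mult_powers:
  assumes "subgroup M G" "x \<in> carrier G"
  shows "subgroup {m \<otimes> x [^] k | m k. m \<in> M \<and> k \<in> (UNIV :: int set)} G" (is "subgroup ?H G")
proof -
  interpret M: subgroup M G by fact
  show ?thesis
  proof (rule subgroupI)
    show "?H \<subseteq> carrier G"
      using assms(2) by auto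
    show "?H \<noteq> {}"
      using M.one_closed by blast
    fix u assume "u \<in> ?H"
    then obtain m k where u: "u = m \<otimes> x [^] (k::int)" "m \<in> M" by auto
    then have "inv u = inv m \<otimes> x [^] (- k)"
      using assms(2) by (simp add: inv_mult int_pow_neg)
    then show "inv u \<in> ?H"
      using u by auto
    fix v assume "v \<in> ?H"
    then obtain n l where v: "v = n \<otimes> x [^] (l::int)" "n \<in> M" by auto
    have "u \<otimes> v = (m \<otimes> n) \<otimes> x [^] (k + l)"
      using assms(2) u v by (simp add: int_pow_mult m_ac)
    then show "u \<otimes> v \<in> ?H"
      using u v by auto
  qed
qed

text \<open>Zorn's lemma applies: the trivial subgroup avoids \<open>b\<close>, and the union of a
  nonempty chain is a subgroup because any two of its elements lie in a common member.\<close>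

lemma exists_maximal_subgroup_avoiding:
  assumes "b \<in> carrier G" "b \<noteq> \<one>"
  obtains M where "subgroup M G" "b \<notin> M"
    "\<And>H. subgroup H G \<Longrightarrow> b \<notin> H \<Longrightarrow> M \<subseteq> H \<Longrightarrow> H = M"
proof -
  let ?A = "{H. subgroup H G \<and> b \<notin> H}"
  have "\<exists>M\<in>?A. \<forall>H\<in>?A. M \<subseteq> H \<longrightarrow> H = M"
  proof (rule subset_Zorn_nonempty)
    show "?A \<noteq> {}"
      using assms triv_subgroup by auto
    fix C assume C: "C \<noteq> {}" "subset.chain ?A C"
    then have sub: "subgroup H G" "b \<notin> H" if "H \<in> C" for H
      using that by (auto simp: subset_chain_def)
    have "subgroup (\<Union>C) G"
    proof (rule subgroupI)
      show "\<Union>C \<subseteq> carrier G"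
        using sub(1) subgroup.subset by blast
      show "\<Union>C \<noteq> {}"
        using C sub(1) subgroup.one_closed by blast
      fix x assume "x \<in> \<Union>C"
      then obtain H where H: "H \<in> C" "x \<in> H" by auto
      then show "inv x \<in> \<Union>C"
        using subgroup.m_inv_closed[OF sub(1)] by auto
      fix y assume "y \<in> \<Union>C"
      then obtain K where K: "K \<in> C" "y \<in> K" by auto
      have "H \<subseteq> K \<or> K \<subseteq> H"
        using C H K by (auto simp: subset_chain_def)
      then show "x \<otimes> y \<in> \<Union>C"
        using H K subgroup.m_closed[OF sub(1)] by (meson UnionI subsetD)
    qed
    then show "\<Union>C \<in> ?A"
      using sub(2) by auto
  qed
  then show ?thesis
    using that by blast
qed

text \<open>A subgroup that is maximal among those avoiding \<open>b\<close> has the powers of \<open>b\<close> as a full set of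
  coset representatives; the exponent of \<open>b\<close>, read off modulo \<open>p\<close>, is the character.\<close>

lemma exists_character:
  fixes p :: nat
  assumes "Factorial_Ring.prime p" "\<And>x. x \<in> carrier G \<Longrightarrow> x [^] p = \<one>"
    and b: "b \<in> carrier G" "b \<noteq> \<one>"
  obtains h where "character_mod G (int p) h" "\<not> int p dvd h b"
proof -
  obtain M where M: "subgroup M G" "b \<notin> M"
    and max: "\<And>H. subgroup H G \<Longrightarrow> b \<notin> H \<Longrightarrow> M \<subseteq> H \<Longrightarrow> H = M"
    using exists_maximal_subgroup_avoiding b by blast
  interpret M: subgroup M G by fact
  have prime: "Factorial_Ring.prime (int p)"
    using assms(1) by simp
  have pow_dvd: "x [^] k = \<one>" if x: "x \<in> carrier G" and k: "int p dvd k" for x and k :: int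
  proof -
    obtain l where "k = int p * l" using k by blast
    then have "x [^] k = (x [^] int p) [^] l"
      using x by (simp add: int_pow_pow)
    then show ?thesis
      using assms(2)[OF x] by (simp add: int_pow_int)
  qed
  \<comment> \<open>Exponents matter only modulo \<open>p\<close>, so raising to a power prime to
    \<open>p\<close> can be undone.\<close>
  have inverse: "\<exists>s. \<forall>x\<in>carrier G. x [^] (t * s) = x" if "\<not> int p dvd t" for t :: int
  proof -
    have "coprime t (int p)"
      using prime that by (metis coprime_commute prime_imp_coprime)
    then obtain s where s: "[t * s = 1] (mod int p)"
      using cong_solve_coprime_int by blast
    have "x [^] (t * s) = x" if x: "x \<in> carrier G" for x
    proof -
      have "x [^] (t * s) = x [^] (t * s - 1 + 1)" by simp
      also have "\<dots> = x [^] (t * s - 1) \<otimes> x"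
        using x by (subst int_pow_mult) (auto simp: int_pow_1)
      also have "x [^] (t * s - 1) = \<one>"
        using x s by (intro pow_dvd) (auto simp: cong_iff_dvd_diff)
      finally show ?thesis using x by simp
    qed
    then show ?thesis by blast
  qed
  have pow_M: "m [^] k \<in> M" if "m \<in> M" for m and k :: int
    using that M(1) int_pow_closed by (simp add: subgroup_int_pow_closed)
  \<comment> \<open>Otherwise \<open>b\<close> would be a power of \<open>b [^] t\<close> and would
    lie in \<open>M\<close>.\<close>
  have dvd_t: "int p dvd t" if "b [^] t \<in> M" for t :: int
  proof (rule ccontr)
    assume "\<not> int p dvd t"
    then obtain s where "b [^] (t * s) = b"
      using inverse b by blast
    then have "b = (b [^] t) [^] s"
      using b by (simp add: int_pow_pow)
    then show False
      using pow_M[OF that, of s] M(2) by simp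
  qed
  \<comment> \<open>For \<open>x\<close> outside \<open>M\<close>, maximality puts \<open>b\<close>
    into the subgroup generated by \<open>M\<close> and \<open>x\<close>, say
    \<open>b = m \<otimes> x [^] k\<close>. Here \<open>p\<close> does not divide \<open>k\<close>,
    as \<open>b\<close> would otherwise equal \<open>m\<close>; inverting \<open>k\<close> expresses
    \<open>x\<close> by a power of \<open>b\<close> modulo \<open>M\<close>.\<close>
  have "\<exists>j::int. x \<otimes> b [^] (- j) \<in> M" if x: "x \<in> carrier G" for x
  proof (cases "x \<in> M")
    case True
    then show ?thesis
      by (intro exI[of _ 0]) simp
  next
    case False
    let ?H = "{m \<otimes> x [^] k | m k. m \<in> M \<and> k \<in> (UNIV :: int set)}"
    have "m = m \<otimes> x [^] (0::int)" if "m \<in> M" for m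
      using that x by simp
    then have "M \<subseteq> ?H" by blast
    moreover have "x = \<one> \<otimes> x [^] (1::int)"
      using x by (simp add: int_pow_1)
    then have "x \<in> ?H"
      using M.one_closed by blast
    ultimately have "b \<in> ?H"
      using max[OF subgroup_mult_powers[OF M(1) x]] False by blast
    then obtain m k where mk: "b = m \<otimes> x [^] (k::int)" "m \<in> M" by auto
    have "\<not> int p dvd k"
      using mk pow_dvd[OF x, of k] M(2) by auto
    then obtain j where j: "x [^] (k * j) = x"
      using inverse x by blast
    have "b [^] j = m [^] j \<otimes> x"
      using mk x j by (simp add: int_pow_distrib int_pow_pow)
    then have "x \<otimes> b [^] (- j) = inv (m [^] j)"
      using x mk b by (simp add: int_pow_neg inv_mult m_ac) (simp add: m_assoc[symmetric])
    then show ?thesis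
      using pow_M[OF mk(2)] by (metis M.m_inv_closed)
  qed
  then have "\<forall>x\<in>carrier G. \<exists>j::int. x \<otimes> b [^] (- j) \<in> M"
    by blast
  then have "\<exists>h. \<forall>x\<in>carrier G. x \<otimes> b [^] (- h x :: int) \<in> M"
    by (rule bchoice)
  then obtain h :: "'a \<Rightarrow> int" where "\<forall>x\<in>carrier G. x \<otimes> b [^] (- h x) \<in> M" ..
  then have h: "x \<otimes> b [^] (- h x) \<in> M" if "x \<in> carrier G" for x
    using that by (rule bspec)
  \<comment> \<open>Combining the elements of \<open>M\<close> attached to \<open>x\<close>,
    \<open>y\<close> and \<open>x \<otimes> y\<close> leaves a pure power of \<open>b\<close> in
    \<open>M\<close>, whose exponent \<open>p\<close> divides by \<open>dvd_t\<close>.\<close>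
  have "[h (x \<otimes> y) = h x + h y] (mod int p)" if xy: "x \<in> carrier G" "y \<in> carrier G" for x y
  proof -
    have cancel: "x \<otimes> (y \<otimes> (inv x \<otimes> (inv y \<otimes> z))) = z" if "z \<in> carrier G" for z
      using xy that by (subst m_lcomm[of y "inv x"]) (simp_all add: m_assoc[symmetric])
    have "x \<otimes> b [^] (- h x) \<otimes> (y \<otimes> b [^] (- h y)) \<otimes> inv (x \<otimes> y \<otimes> b [^] (- h (x \<otimes> y))) \<in> M"
      using xy by (intro M.m_closed M.m_inv_closed h) auto
    also have "x \<otimes> b [^] (- h x) \<otimes> (y \<otimes> b [^] (- h y)) \<otimes> inv (x \<otimes> y \<otimes> b [^] (- h (x \<otimes> y))) =
        x \<otimes> y \<otimes> inv (x \<otimes> y) \<otimes> (b [^] (- h x) \<otimes> b [^] (- h y) \<otimes> b [^] (h (x \<otimes> y)))"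
      using xy b by (simp add: inv_mult_group int_pow_neg m_ac cancel)
    also have "\<dots> = b [^] (h (x \<otimes> y) - h x - h y)"
      using xy b by (simp add: int_pow_mult[symmetric] algebra_simps)
    finally show ?thesis
      by (auto dest!: dvd_t simp: cong_iff_dvd_diff algebra_simps)
  qed
  moreover have "\<not> int p dvd h b"
  proof
    assume "int p dvd h b"
    then have "b [^] (- h b) = \<one>"
      using pow_dvd b by simp
    then show False
      using h[OF b(1)] b M(2) by simp
  qed
  ultimately show ?thesis
    by (intro that[of h]) (auto simp: character_mod_def)
qed

end

section \<open>Transfer of the functional degree along characters\<close>

lemma pow_group_exponent:
  assumes "group_exponent B > 0" "x \<in> carrier B"
  shows "x [^]\<^bsub>B\<^esub> group_exponent B = \<one>\<^bsub>B\<^esub>"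
proof -
  let ?P = "\<lambda>n::nat. n > 0 \<and> (\<forall>b\<in>carrier B. b [^]\<^bsub>B\<^esub> n = \<one>\<^bsub>B\<^esub>)"
  have "\<exists>n. ?P n"
    using assms(1) by (auto simp: group_exponent_def split: if_splits)
  then have "?P (LEAST n. ?P n)"
    by (rule LeastI_ex)
  then show ?thesis
    using \<open>\<exists>n. ?P n\<close> assms(2) by (simp add: group_exponent_def)
qed

text \<open>The character turns products in \<open>B\<close> into sums and powers into multiples,
  term by term.\<close>

lemma int_act_character:
  assumes "comm_group A" "comm_group B" "character_mod B p h" "f \<in> carrier A \<rightarrow> carrier B"
    and "Poly_Mapping.keys u \<subseteq> carrier A" "x \<in> carrier A"
  shows "[h (ring_act A B u f x) = int_act A u (h \<circ> f) x] (mod p)"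
proof -
  interpret A: comm_group A by fact
  interpret B: comm_group B by fact
  have f: "f (x \<otimes>\<^bsub>A\<^esub> a) \<in> carrier B" if "a \<in> Poly_Mapping.keys u" for a
    using that assms by auto
  have "[h (ring_act A B u f x) = (\<Sum>a\<in>Poly_Mapping.keys u.
      h (f (x \<otimes>\<^bsub>A\<^esub> a) [^]\<^bsub>B\<^esub> Poly_Mapping.lookup u a))] (mod p)"
    unfolding ring_act_def using f
    by (intro B.character_finprod assms) auto
  also have "[(\<Sum>a\<in>Poly_Mapping.keys u. h (f (x \<otimes>\<^bsub>A\<^esub> a) [^]\<^bsub>B\<^esub> Poly_Mapping.lookup u a)) =
      int_act A u (h \<circ> f) x] (mod p)"
    unfolding int_act_def o_def using f
    by (intro cong_sum B.character_int_pow assms) auto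
  finally show ?thesis .
qed

text \<open>Composition with a character does not raise the degree: products of generators lie in
  the power of the ideal, and the character sends the neutral element to 0 modulo
  \<open>p\<close>.\<close>

lemma deg_less_character:
  assumes "comm_group A" "comm_group B" "character_mod B p h" "f \<in> carrier A \<rightarrow> carrier B"
    and ann: "annihilates A B (ideal_power (group_ring A) (augmentation_ideal A) n) f"
  shows "deg_less A p n (h \<circ> f)"
proof -
  interpret A: comm_group A by fact
  interpret B: comm_group B by fact
  interpret R: cring "group_ring A"
    by (rule cring_group_ring[OF assms(1)])
  show ?thesis
  proof (rule A.deg_less_if_int_act)
    fix a x
    assume a: "a \<in> {..<n} \<rightarrow> carrier A" and x: "x \<in> carrier A"
    define D where "D i = frag_of (a i) - frag_of \<one>\<^bsub>A\<^esub>" for i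
    let ?P = "\<Otimes>\<^bsub>group_ring A\<^esub>i\<in>{..<n}. D i"
    have gens: "{frag_of a - frag_of \<one>\<^bsub>A\<^esub> | a. a \<in> carrier A} \<subseteq> carrier (group_ring A)"
    proof clarify
      fix c assume "c \<in> carrier A"
      then show "frag_of c - frag_of \<one>\<^bsub>A\<^esub> \<in> carrier (group_ring A)"
        using keys_diff[of "frag_of c" "frag_of \<one>\<^bsub>A\<^esub>"] by (auto simp: group_ring_simps)
    qed
    have aug: "augmentation_ideal A \<subseteq> carrier (group_ring A)"
      unfolding augmentation_ideal_def
      by (intro subsetI ideal.Icarr[OF R.genideal_ideal[OF gens]])
    have D: "D i \<in> augmentation_ideal A" if "i < n" for i
    proof -
      have "a i \<in> carrier A"
        using a that by auto
      then show ?thesis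
        unfolding augmentation_ideal_def D_def by (intro subsetD[OF R.genideal_self[OF gens]]) blast
    qed
    have "{\<Otimes>\<^bsub>group_ring A\<^esub>i\<in>{..<n}. x i | x. x \<in> {..<n} \<rightarrow> augmentation_ideal A}
        \<subseteq> carrier (group_ring A)"
      using subsetD[OF aug] by (auto intro!: R.finprod_closed)
    then have P: "?P \<in> ideal_power (group_ring A) (augmentation_ideal A) n"
      unfolding ideal_power_def using D by (intro subsetD[OF R.genideal_self]) auto
    have "?P \<in> carrier (group_ring A)"
      by (intro R.finprod_closed funcsetI subsetD[OF aug] D) simp
    then have "[h (ring_act A B ?P f x) = int_act A ?P (h \<circ> f) x] (mod p)"
      by (intro int_act_character assms x) (simp add: group_ring_simps)
    moreover have "ring_act A B ?P f x = \<one>\<^bsub>B\<^esub>"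
      using ann P x by (auto simp: annihilates_def)
    ultimately show "p dvd int_act A
        (\<Otimes>\<^bsub>group_ring A\<^esub>i\<in>{..<n}. frag_of (a i) - frag_of \<one>\<^bsub>A\<^esub>) (h \<circ> f) x"
      using B.character_one[OF assms(3)] unfolding D_def[symmetric]
      by (simp add: cong_def dvd_eq_mod_eq_0)
  qed
qed

text \<open>Finiteness makes the set of admissible bounds nonempty, and its infimum is attained
  because the extended naturals are well-ordered.\<close>

lemma annihilates_Fdeg:
  assumes "Fdeg A B f \<noteq> \<infinity>"
  shows "annihilates A B
    (ideal_power (group_ring A) (augmentation_ideal A) (Suc (the_enat (Fdeg A B f)))) f"
proof -
  define P where "P n \<longleftrightarrow> annihilates A B
    (ideal_power (group_ring A) (augmentation_ideal A) (n + 1)) f" for n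
  have Fdeg: "Fdeg A B f = Inf {enat n | n. P n}"
    by (simp only: Fdeg_def P_def)
  have "\<exists>n. P n"
  proof (rule ccontr)
    assume "\<nexists>n. P n"
    then have "Fdeg A B f = \<infinity>"
      by (simp add: Fdeg Inf_enat_def)
    then show False
      using assms by simp
  qed
  then obtain m where "P m" ..
  then have "enat m \<in> {enat n | n. P n}"
    by simp
  then have "Fdeg A B f \<in> {enat n | n. P n}"
    unfolding Fdeg by (rule wellorder_InfI)
  then obtain n where "Fdeg A B f = enat n" "P n"
    by auto
  then show ?thesis
    by (simp add: P_def)
qed


section \<open>Sums of functions of low degree vanish modulo \<open>p\<close>\<close>

text \<open>With \<open>q = p ^ n\<close>, \<open>q\<close> divides \<open>j * (q choose j)\<close>.
  Were the binomial prime to \<open>p\<close>, \<open>q\<close> would divide the smaller positive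
  number \<open>j\<close>.\<close>

lemma prime_dvd_choose_prime_power:
  assumes "Factorial_Ring.prime p" "0 < j" "j < p ^ n"
  shows "p dvd (p ^ n choose j)"
proof (rule ccontr)
  assume "\<not> p dvd (p ^ n choose j)"
  then have "coprime (p ^ n) (p ^ n choose j)"
    using assms(1) prime_imp_coprime by auto
  moreover have "p ^ n dvd j * (p ^ n choose j)"
    using assms times_binomial_minus1_eq[of j "p ^ n"] by simp
  ultimately have "p ^ n dvd j"
    using coprime_dvd_mult_left_iff by blast
  then show False
    using assms by (simp add: nat_dvd_not_less)
qed

text \<open>By Pascal's rule neighbouring coefficients add up to \<open>p ^ n choose Suc j\<close>,
  which is 0 modulo \<open>p\<close>. The sign is that of the iterated difference; the induction
  descends from \<open>j = p ^ n - 1\<close>, where the sign exponent is even.\<close>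

lemma choose_prime_power_minus_one_cong:
  assumes "Factorial_Ring.prime p" "j < p ^ n"
  shows "[(- 1) ^ (p ^ n - 1 + j) * int (p ^ n - 1 choose j) = 1] (mod int p)"
proof -
  have "j \<le> p ^ n - 1"
    using assms(2) by simp
  then show ?thesis
  proof (induction j rule: inc_induct)
    case base
    then show ?case by (simp flip: mult_2)
  next
    case (step j)
    have q: "p ^ n = Suc (p ^ n - 1)"
      using step by simp
    have "p dvd (p ^ n choose Suc j)"
      using assms(1) step by (intro prime_dvd_choose_prime_power) auto
    then have "int p dvd int (p ^ n - 1 choose j) + int (p ^ n - 1 choose Suc j)"
      by (subst (asm) q) (simp flip: of_nat_add add: int_dvd_int_iff)
    then have "int p dvd (- 1) ^ (p ^ n - 1 + j) *
        (int (p ^ n - 1 choose j) + int (p ^ n - 1 choose Suc j))"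
      by simp
    then have "[(- 1) ^ (p ^ n - 1 + j) * int (p ^ n - 1 choose j) =
        (- 1) ^ (p ^ n - 1 + Suc j) * int (p ^ n - 1 choose Suc j)] (mod int p)"
      by (simp add: cong_iff_dvd_diff algebra_simps)
    then show ?case
      using step.IH cong_trans by blast
  qed
qed

context comm_group
begin

text \<open>This is the binomial expansion of \<open>(\<tau>\<^sub>e - 1) ^ m\<close>. The sign
  exponent \<open>m + j\<close> has the parity of \<open>m - j\<close> and avoids
  subtraction.\<close>

lemma iterated_difference:
  assumes "e \<in> carrier G" "x \<in> carrier G"
  shows "((\<lambda>F x. F (x \<otimes> e) - F x) ^^ m) F x =
    (\<Sum>j\<le>m. (- 1) ^ (m + j) * int (m choose j) * F (x \<otimes> e [^] j))"
  using assms(2)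
proof (induction m arbitrary: x)
  case (Suc m)
  let ?t = "\<lambda>j. (- 1) ^ (m + j) * int (m choose j) * F (x \<otimes> e [^] j)"
  let ?s = "\<lambda>j. (- 1) ^ (m + j) * int (m choose j) * F (x \<otimes> e [^] Suc j)"
  have "((\<lambda>F x. F (x \<otimes> e) - F x) ^^ Suc m) F x =
      (\<Sum>j\<le>m. (- 1) ^ (m + j) * int (m choose j) * F (x \<otimes> e \<otimes> e [^] j)) - (\<Sum>j\<le>m. ?t j)"
    using Suc assms(1) by simp
  also have "(\<Sum>j\<le>m. (- 1) ^ (m + j) * int (m choose j) * F (x \<otimes> e \<otimes> e [^] j)) = (\<Sum>j\<le>m. ?s j)"
    using Suc.prems assms(1) by (intro sum.cong) (auto simp: m_ac)
  \<comment> \<open>The added term has the coefficient \<open>m choose Suc m\<close>, which is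
    0.\<close>
  also have "(\<Sum>j\<le>m. ?t j) = (\<Sum>j\<le>Suc m. ?t j)"
    by simp
  also have "\<dots> = ?t 0 + (\<Sum>j\<le>m. ?t (Suc j))"
    by (rule sum.atMost_Suc_shift)
  also have "(\<Sum>j\<le>m. ?s j) - (?t 0 + (\<Sum>j\<le>m. ?t (Suc j))) =
      - ?t 0 + (\<Sum>j\<le>m. ?s j - ?t (Suc j))"
    by (simp add: sum_subtractf sum_negf)
  \<comment> \<open>The two terms carry opposite signs, so the coefficients add by Pascal's
    rule.\<close>
  also have "(\<Sum>j\<le>m. ?s j - ?t (Suc j)) =
      (\<Sum>j\<le>m. (- 1) ^ (Suc m + Suc j) * int (Suc m choose Suc j) * F (x \<otimes> e [^] Suc j))"
    by (intro sum.cong) (simp_all add: algebra_simps)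
  also have "- ?t 0 + \<dots> =
      (\<Sum>j\<le>Suc m. (- 1) ^ (Suc m + j) * int (Suc m choose j) * F (x \<otimes> e [^] j))"
    by (subst sum.atMost_Suc_shift) simp
  finally show ?case .
qed simp

lemma deg_less_iterated_difference:
  assumes "deg_less G p (n + m) F" "e \<in> carrier G"
  shows "deg_less G p n (((\<lambda>F x. F (x \<otimes> e) - F x) ^^ m) F)"
  using assms(1)
proof (induction m arbitrary: n)
  case (Suc m)
  have "deg_less G p (Suc n) (((\<lambda>F x. F (x \<otimes> e) - F x) ^^ m) F)"
    using Suc.IH[of "Suc n"] Suc.prems by simp
  then show ?case
    using assms(2) by simp
qed simp

text \<open>In \<open>\<int>\<^sub>p[X]\<close> one has \<open>1 + X + \<dots> + X\<^bsup>q-1\<^esup> = (X - 1)\<^bsup>q-1\<^esup>\<close> for a power \<open>q\<close> of \<open>p\<close>.\<close>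

lemma deg_less_sum_powers:
  assumes "Factorial_Ring.prime p" "e \<in> carrier G" "deg_less G (int p) (n + (p ^ \<alpha> - 1)) F"
  shows "deg_less G (int p) n (\<lambda>x. \<Sum>j<p ^ \<alpha>. F (x \<otimes> e [^] j))"
proof (rule deg_less_cong)
  show "deg_less G (int p) n (((\<lambda>F x. F (x \<otimes> e) - F x) ^^ (p ^ \<alpha> - 1)) F)"
    using assms by (intro deg_less_iterated_difference)
  fix x assume x: "x \<in> carrier G"
  have "p ^ \<alpha> > 0"
    using assms(1) prime_gt_0_nat by simp
  then have interval: "{..p ^ \<alpha> - 1} = {..<p ^ \<alpha>}"
    by (metis Suc_diff_1 lessThan_Suc_atMost)
  have "[((\<lambda>F x. F (x \<otimes> e) - F x) ^^ (p ^ \<alpha> - 1)) F x =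
      (\<Sum>j<p ^ \<alpha>. 1 * F (x \<otimes> e [^] j))] (mod int p)"
    unfolding iterated_difference[OF assms(2) x] interval
    by (intro cong_sum cong_mult choose_prime_power_minus_one_cong[OF assms(1)] cong_refl) simp
  then show "int p dvd ((\<lambda>F x. F (x \<otimes> e) - F x) ^^ (p ^ \<alpha> - 1)) F x -
      (\<Sum>j<p ^ \<alpha>. F (x \<otimes> e [^] j))"
    by (simp add: cong_iff_dvd_diff)
qed

end

section \<open>Summation over a product of cyclic groups\<close>

lemma comm_group_product_group:
  assumes "\<And>i. i \<in> I \<Longrightarrow> comm_group (G i)"
  shows "comm_group (product_group I G)"
proof (rule group.group_comm_groupI)
  show "group (product_group I G)"
    using assms by (simp add: comm_group.axioms(2))
  fix x y assume "x \<in> carrier (product_group I G)" "y \<in> carrier (product_group I G)"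
  then show "x \<otimes>\<^bsub>product_group I G\<^esub> y = y \<otimes>\<^bsub>product_group I G\<^esub> x"
    using assms by (auto simp: PiE_iff comm_monoid.m_comm comm_group.axioms(1) intro!: restrict_ext)
qed

text \<open>The base is the generator of the \<open>i\<close>-th factor. Its entry is
  \<open>1 mod int (q i)\<close> because a factor of order 1 contains only 0.\<close>

lemma nat_pow_product_integer_mod_group:
  fixes q :: "'i \<Rightarrow> nat" and j :: nat
  shows "(\<lambda>l\<in>I. if l = i then 1 mod int (q i) else 0)
      [^]\<^bsub>product_group I (\<lambda>i. integer_mod_group (q i))\<^esub> j =
    (\<lambda>l\<in>I. if l = i then int j mod int (q i) else 0)"
proof (induction j)
  case (Suc j)
  then show ?case
    by (auto simp: mod_simps add.commute intro!: restrict_ext)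
qed (auto intro!: restrict_ext)

text \<open>Coordinates in \<open>S\<close> are summed out one at a time, the others staying 0. Each
  costs \<open>p ^ \<alpha> i - 1\<close> of the bound, so \<open>n\<close> must vary in the
  induction.\<close>

lemma deg_less_sum_subproduct:
  fixes p :: nat and \<alpha> :: "'i \<Rightarrow> nat" and I :: "'i set"
  defines "G \<equiv> product_group I (\<lambda>i. integer_mod_group (p ^ \<alpha> i))"
  assumes p: "Factorial_Ring.prime p" and "finite S" "S \<subseteq> I"
    and "deg_less G (int p) (n + (\<Sum>i\<in>S. p ^ \<alpha> i - 1)) F"
  shows "deg_less G (int p) n
    (\<lambda>x. \<Sum>y\<in>PiE I (\<lambda>i. if i \<in> S then {0..<int (p ^ \<alpha> i)} else {0}). F (x \<otimes>\<^bsub>G\<^esub> y))"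
  using assms(3-5)
proof (induction S arbitrary: n rule: finite_induct)
  interpret comm_group G
    unfolding G_def by (intro comm_group_product_group) simp
  {
    case empty
    have "PiE I (\<lambda>i. {0::int}) = {\<one>\<^bsub>G\<^esub>}"
      by (simp add: G_def PiE_eq_singleton)
    then show ?case
      by (intro deg_less_cong[OF _ empty.prems(2)[simplified]]) simp
  next
    case (insert i S)
    define P where "P S = PiE I (\<lambda>i. if i \<in> S then {0..<int (p ^ \<alpha> i)} else {0})" for S
    define e where "e = (\<lambda>l\<in>I. if l = i then 1 mod int (p ^ \<alpha> i) else 0)"
    have pos: "p > 0"
      using p prime_gt_0_nat by simp
    have carrier: "carrier G = PiE I (\<lambda>i. {0..<int (p ^ \<alpha> i)})"
      using pos by (simp add: G_def carrier_integer_mod_group del: of_nat_power)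
    have e: "e \<in> carrier G"
      using pos by (auto simp: carrier e_def)
    have P: "y \<in> carrier G" if "y \<in> P T" for y T
      using that pos by (auto simp: carrier P_def PiE_iff split: if_splits)
    have e_pow: "e [^]\<^bsub>G\<^esub> j = (\<lambda>l\<in>I. if l = i then int j mod int (p ^ \<alpha> i) else 0)" for j
      unfolding e_def G_def by (rule nat_pow_product_integer_mod_group)
    \<comment> \<open>Since \<open>y\<close> is 0 at \<open>i\<close>, adding \<open>j\<close> times
      the generator just writes \<open>j\<close> there. This identifies the double sum with the sum
      over the larger subproduct.\<close>
    have update: "e [^]\<^bsub>G\<^esub> j \<otimes>\<^bsub>G\<^esub> y = y(i := int j)" if "j < p ^ \<alpha> i" "y \<in> P S" for j y
    proof
      fix l
      have y: "y l = undefined" if "l \<notin> I"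
        using \<open>y \<in> P S\<close> that by (auto simp: P_def)
      have y': "0 \<le> y l" "y l < int (p ^ \<alpha> l)" if "l \<in> I"
        using P[OF \<open>y \<in> P S\<close>] that unfolding carrier by (auto simp: PiE_iff simp del: of_nat_power)
      have "y i = 0" "i \<in> I"
        using \<open>y \<in> P S\<close> insert.prems(1) insert.hyps(2) by (auto simp: P_def PiE_iff)
      then show "(e [^]\<^bsub>G\<^esub> j \<otimes>\<^bsub>G\<^esub> y) l = (y(i := int j)) l"
        using y y' \<open>j < p ^ \<alpha> i\<close> unfolding e_pow
        by (auto simp: G_def simp del: of_nat_power)
    qed
    have "deg_less G (int p) (n + (p ^ \<alpha> i - 1)) (\<lambda>x. \<Sum>y\<in>P S. F (x \<otimes>\<^bsub>G\<^esub> y))"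
      unfolding P_def using insert by (intro insert.IH) (simp_all add: add.assoc)
    then have deg: "deg_less G (int p) n
        (\<lambda>x. \<Sum>j<p ^ \<alpha> i. \<Sum>y\<in>P S. F (x \<otimes>\<^bsub>G\<^esub> e [^]\<^bsub>G\<^esub> j \<otimes>\<^bsub>G\<^esub> y))"
      by (rule deg_less_sum_powers[OF p e])
    have "(\<Sum>j<p ^ \<alpha> i. \<Sum>y\<in>P S. F (x \<otimes>\<^bsub>G\<^esub> e [^]\<^bsub>G\<^esub> j \<otimes>\<^bsub>G\<^esub> y)) =
        (\<Sum>z\<in>P (insert i S). F (x \<otimes>\<^bsub>G\<^esub> z))" if x: "x \<in> carrier G" for x
    proof -
      have "(\<Sum>j<p ^ \<alpha> i. \<Sum>y\<in>P S. F (x \<otimes>\<^bsub>G\<^esub> e [^]\<^bsub>G\<^esub> j \<otimes>\<^bsub>G\<^esub> y)) =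
          (\<Sum>(j, y)\<in>{..<p ^ \<alpha> i} \<times> P S. F (x \<otimes>\<^bsub>G\<^esub> (y(i := int j))))"
        unfolding sum.cartesian_product using x e P
        by (intro sum.cong) (auto simp: m_assoc update)
      also have "\<dots> = (\<Sum>z\<in>P (insert i S). F (x \<otimes>\<^bsub>G\<^esub> z))"
        using insert.prems(1) insert.hyps(2) pos
        by (intro sum.reindex_bij_witness[of _ "\<lambda>z. (nat (z i), z(i := 0))" "\<lambda>(j, y). y(i := int j)"])
          (auto simp: P_def PiE_iff extensional_def fun_eq_iff nat_less_iff split: if_splits)
      finally show ?thesis .
    qed
    then show ?case
      unfolding P_def[symmetric] by (intro deg_less_cong[OF _ deg]) simp
  }
qed

text \<open>Once all coordinates are summed out the bound left is 0, so every value of the sum is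
  divisible by \<open>p\<close>; the value at the neutral element is the claim.\<close>

lemma sum_deg_less_product_group:
  fixes p :: nat and \<alpha> :: "'i \<Rightarrow> nat" and I :: "'i set"
  defines "G \<equiv> product_group I (\<lambda>i. integer_mod_group (p ^ \<alpha> i))"
  assumes "Factorial_Ring.prime p" "finite I"
    and "deg_less G (int p) (\<Sum>i\<in>I. p ^ \<alpha> i - 1) F"
  shows "int p dvd (\<Sum>x\<in>carrier G. F x)"
proof -
  interpret comm_group G
    unfolding G_def by (intro comm_group_product_group) simp
  have carrier: "carrier G = PiE I (\<lambda>i. if i \<in> I then {0..<int (p ^ \<alpha> i)} else {0})"
    using assms(2) by (auto simp: G_def carrier_integer_mod_group intro!: PiE_cong)
  have "deg_less G (int p) 0 (\<lambda>x. \<Sum>y\<in>carrier G. F (x \<otimes>\<^bsub>G\<^esub> y))"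
    using assms deg_less_sum_subproduct[of p I I \<alpha> 0 F] unfolding carrier by (simp add: G_def)
  then have "int p dvd (\<Sum>y\<in>carrier G. F (\<one>\<^bsub>G\<^esub> \<otimes>\<^bsub>G\<^esub> y))"
    unfolding deg_less.simps by (rule bspec) simp
  then show ?thesis
    by simp
qed


section \<open>The indicator function of the common zeros\<close>

text \<open>The witness is \<open>\<Prod>\<^bsub>b\<^esub> (h\<^sub>b \<circ> f - h\<^sub>b(b))\<close> over the nonzero values \<open>b\<close> of \<open>f\<close>, for characters
  \<open>h\<^sub>b\<close> with \<open>h\<^sub>b(b) \<noteq> 0\<close>.\<close>

lemma exists_zero_indicator:
  fixes p :: nat
  assumes A: "comm_group A" and "finite (carrier A)" and B: "comm_group B"
    and p: "Factorial_Ring.prime p" "\<And>b. b \<in> carrier B \<Longrightarrow> b [^]\<^bsub>B\<^esub> p = \<one>\<^bsub>B\<^esub>"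
    and f: "f \<in> carrier A \<rightarrow> carrier B" and zero: "\<one>\<^bsub>B\<^esub> \<in> f ` carrier A"
    and fin: "enat (card (f ` carrier A) - 1) * Fdeg A B f \<noteq> \<infinity>"
  obtains g c where
    "deg_less A (int p)
      (Suc (the_enat (enat (card (f ` carrier A) - 1) * Fdeg A B f))) g"
    "\<And>x. x \<in> carrier A \<Longrightarrow> f x \<noteq> \<one>\<^bsub>B\<^esub> \<Longrightarrow> int p dvd g x"
    "\<And>x. x \<in> carrier A \<Longrightarrow> f x = \<one>\<^bsub>B\<^esub> \<Longrightarrow> [g x = c] (mod int p)"
    "\<not> int p dvd c"
proof -
  interpret A: comm_group A by fact
  interpret B: comm_group B by fact
  let ?R = "f ` carrier A - {\<one>\<^bsub>B\<^esub>}"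
  \<comment> \<open>As 0 is a value of \<open>f\<close>, there is one factor fewer than there are
    values.\<close>
  have R: "finite ?R" "card ?R = card (f ` carrier A) - 1"
    using assms(2) zero by auto
  have "\<forall>b\<in>?R. \<exists>h. character_mod B (int p) h \<and> \<not> int p dvd h b"
    using B.exists_character[OF p] f by (metis DiffE Pi_iff imageE insertCI)
  then obtain h where h: "\<And>b. b \<in> ?R \<Longrightarrow> character_mod B (int p) (h b)"
    and hb: "\<And>b. b \<in> ?R \<Longrightarrow> \<not> int p dvd h b b"
    using bchoice[of ?R "\<lambda>b h. character_mod B (int p) h \<and> \<not> int p dvd h b"] by blast
  define g where "g x = (\<Prod>b\<in>?R. h b (f x) - h b b)" for x
  define c where "c = (\<Prod>b\<in>?R. - h b b)"
  show ?thesis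
  proof
    show "deg_less A (int p) (Suc (the_enat (enat (card (f ` carrier A) - 1) * Fdeg A B f))) g"
    \<comment> \<open>Without nonzero values the product in \<open>fin\<close> is 0 and says nothing
      about \<open>Fdeg\<close>; the witness is then the empty product 1.\<close>
    proof (cases "?R = {}")
      case True
      then have "g = (\<lambda>x. 1)"
        by (intro ext) (simp only: g_def prod.empty)
      then show ?thesis
        using A.deg_less_mono[OF A.deg_less_const] by (simp del: deg_less.simps)
    next
      case False
      then have "card ?R \<noteq> 0"
        using R(1) by simp
      then have "enat (card (f ` carrier A) - 1) > 0"
        unfolding R(2) by (simp add: zero_enat_def)
      then have Fdeg: "Fdeg A B f \<noteq> \<infinity>"
        using fin imult_infinity_right by metis
      then obtain d where d: "Fdeg A B f = enat d" by auto
      have "deg_less A (int p) (Suc d) (\<lambda>x. h b (f x) - h b b)" if "b \<in> ?R" for b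
      proof (rule A.deg_less_diff)
        show "deg_less A (int p) (Suc d) (\<lambda>x. h b (f x))"
          using deg_less_character[OF A B h[OF that] f annihilates_Fdeg[OF Fdeg]] d
          by (simp add: o_def del: deg_less.simps)
        show "deg_less A (int p) (Suc d) (\<lambda>x. h b b)"
          by (rule A.deg_less_mono[OF A.deg_less_const]) simp
      qed
      then have "deg_less A (int p) (Suc (\<Sum>b\<in>?R. d)) g"
        unfolding g_def by (intro A.deg_less_prod R)
      then show ?thesis
        using d R(2) by (simp del: deg_less.simps)
    qed
    show "int p dvd g x" if "x \<in> carrier A" "f x \<noteq> \<one>\<^bsub>B\<^esub>" for x
    proof -
      \<comment> \<open>The factor for \<open>b = f x\<close> is exactly 0.\<close>
      have "g x = 0"
        unfolding g_def using R(1) that by (intro prod_zero) auto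
      then show ?thesis by simp
    qed
    show "[g x = c] (mod int p)" if "x \<in> carrier A" "f x = \<one>\<^bsub>B\<^esub>" for x
      unfolding g_def c_def
    proof (rule cong_prod)
      fix b assume "b \<in> ?R"
      then have "[h b (f x) - h b b = 0 - h b b] (mod int p)"
        using B.character_one[OF h] that by (intro cong_diff) auto
      then show "[h b (f x) - h b b = - h b b] (mod int p)"
        by simp
    qed
    have "Factorial_Ring.prime (int p)"
      using p by simp
    then show "\<not> int p dvd c"
      unfolding c_def using hb R(1) by (auto simp: prime_dvd_prod_iff)
  qed
qed

section \<open>Counting the common zeros modulo \<open>p\<close>\<close>

theorem theorem13p5:
  fixes p k r :: nat
    and \<alpha> :: "nat \<Rightarrow> nat"
    and A :: "(nat \<Rightarrow> int) monoid"
    and B :: "('b, 'm) monoid_scheme"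
    and f :: "nat \<Rightarrow> (nat \<Rightarrow> int) \<Rightarrow> 'b"
  assumes "Factorial_Ring.prime p"
    and "k \<ge> 1"
    and "A = product_group {1..k} (\<lambda>i. integer_mod_group (p ^ \<alpha> i))"
    and "comm_group B"
    and "group_exponent B = p"
    and "\<And>i. i \<in> {1..r} \<Longrightarrow> f i \<in> carrier A \<rightarrow> carrier B"
    and "enat (\<Sum>i=1..k. (p ^ \<alpha> i - 1)) >
      (\<Sum>i=1..r. enat (card (f i ` carrier A) - 1) * Fdeg A B (f i))"
  shows "p dvd card (common_zeros A B r f)"
\<comment> \<open>An empty zero set has cardinality 0. Otherwise every \<open>f i\<close> takes the
  value 0, as the indicator construction requires.\<close>
proof (cases "common_zeros A B r f = {}")
  case False
  have A: "comm_group A"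
    unfolding assms(3) by (intro comm_group_product_group) simp
  interpret A: comm_group A by fact
  have p: "Factorial_Ring.prime (int p)" "p > 0"
    using assms(1) prime_gt_0_nat by auto
  have fin: "finite (carrier A)"
    using p(2) by (auto simp: assms(3) carrier_integer_mod_group intro!: finite_PiE)
  define d where "d i = enat (card (f i ` carrier A) - 1) * Fdeg A B (f i)" for i
  have "(\<Sum>i=1..r. d i) < \<infinity>"
    unfolding d_def by (rule order.strict_trans[OF assms(7)]) simp
  \<comment> \<open>An infinite summand would make the whole sum infinite.\<close>
  then have d: "d i \<noteq> \<infinity>" if "i \<in> {1..r}" for i
    using that member_le_sum[of i "{1..r}" d] by (metis finite_atLeastAtMost leD zero_le)
  have exponent: "b [^]\<^bsub>B\<^esub> p = \<one>\<^bsub>B\<^esub>" if "b \<in> carrier B" for b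
    using pow_group_exponent[of B b] assms(5) p(2) that by simp
  define Q where "Q i g c \<longleftrightarrow> deg_less A (int p) (Suc (the_enat (d i))) g \<and>
      (\<forall>x\<in>carrier A. (f i x \<noteq> \<one>\<^bsub>B\<^esub> \<longrightarrow> int p dvd g x) \<and>
        (f i x = \<one>\<^bsub>B\<^esub> \<longrightarrow> [g x = c] (mod int p))) \<and> \<not> int p dvd c" for i g c
  have "\<exists>g c. Q i g c" if i: "i \<in> {1..r}" for i
  proof -
    have zero: "\<one>\<^bsub>B\<^esub> \<in> f i ` carrier A"
      using False i by (force simp: common_zeros_def)
    obtain g c where
      "deg_less A (int p) (Suc (the_enat (d i))) g"
      "\<And>x. x \<in> carrier A \<Longrightarrow> f i x \<noteq> \<one>\<^bsub>B\<^esub> \<Longrightarrow> int p dvd g x"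
      "\<And>x. x \<in> carrier A \<Longrightarrow> f i x = \<one>\<^bsub>B\<^esub> \<Longrightarrow> [g x = c] (mod int p)"
      "\<not> int p dvd c"
      using exists_zero_indicator[OF A fin assms(4,1) exponent assms(6)[OF i] zero] d[OF i]
      unfolding d_def by blast
    then show ?thesis
      unfolding Q_def by blast
  qed
  then obtain g c where "Q i (g i) (c i)" if "i \<in> {1..r}" for i
    by metis
  then have g:
    "\<And>i. i \<in> {1..r} \<Longrightarrow> deg_less A (int p) (Suc (the_enat (d i))) (g i)"
    "\<And>i x. i \<in> {1..r} \<Longrightarrow> x \<in> carrier A \<Longrightarrow> f i x \<noteq> \<one>\<^bsub>B\<^esub> \<Longrightarrow> int p dvd g i x"
    "\<And>i x. i \<in> {1..r} \<Longrightarrow> x \<in> carrier A \<Longrightarrow> f i x = \<one>\<^bsub>B\<^esub> \<Longrightarrow> [g i x = c i] (mod int p)"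
    "\<And>i. i \<in> {1..r} \<Longrightarrow> \<not> int p dvd c i"
    unfolding Q_def by blast+
  let ?V = "common_zeros A B r f"
  define F where "F x = (\<Prod>i=1..r. g i x)" for x
  define C where "C = (\<Prod>i=1..r. c i)"
  have "enat (\<Sum>i=1..r. the_enat (d i)) = (\<Sum>i=1..r. enat (the_enat (d i)))"
    by (simp only: of_nat_eq_enat[symmetric] of_nat_sum)
  also have "\<dots> = (\<Sum>i=1..r. d i)"
    using d by (intro sum.cong refl) (metis not_infinity_eq the_enat.simps)
  \<comment> \<open>Strictness pays for the \<open>Suc\<close> in the bound for
    \<open>F\<close>.\<close>
  finally have "(\<Sum>i=1..r. the_enat (d i)) < (\<Sum>i=1..k. p ^ \<alpha> i - 1)"
    using assms(7) unfolding d_def[symmetric] by (metis enat_ord_simps(2))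
  moreover have "deg_less A (int p) (Suc (\<Sum>i=1..r. the_enat (d i))) F"
    unfolding F_def using g(1) by (intro A.deg_less_prod) auto
  ultimately have "deg_less A (int p) (\<Sum>i=1..k. p ^ \<alpha> i - 1) F"
    using A.deg_less_mono Suc_leI by blast
  then have "int p dvd (\<Sum>x\<in>carrier A. F x)"
    unfolding assms(3) using assms(1) by (intro sum_deg_less_product_group) auto
  \<comment> \<open>Modulo \<open>p\<close>, \<open>F\<close> is \<open>C\<close> on the common
    zeros and 0 elsewhere, so the sum counts them with the factor \<open>C\<close>, which
    \<open>p\<close> does not divide.\<close>
  moreover have "[(\<Sum>x\<in>carrier A. F x) = (\<Sum>x\<in>carrier A. if x \<in> ?V then C else 0)] (mod int p)"
  proof (rule cong_sum)
    fix x assume x: "x \<in> carrier A"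
    show "[F x = (if x \<in> ?V then C else 0)] (mod int p)"
    proof (cases "x \<in> ?V")
      case True
      then have "[F x = C] (mod int p)"
        unfolding F_def C_def using g(3) by (intro cong_prod) (auto simp: common_zeros_def)
      then show ?thesis
        using True by simp
    next
      case False
      then obtain i where "i \<in> {1..r}" "f i x \<noteq> \<one>\<^bsub>B\<^esub>"
        using x by (auto simp: common_zeros_def)
      then have "int p dvd F x"
        unfolding F_def using g(2) x
        by (intro dvd_trans[OF _ dvd_prodI[of "{1..r}" i]]) auto
      then show ?thesis
        using False by (simp add: cong_0_iff)
    qed
  qed
  moreover have "(\<Sum>x\<in>carrier A. if x \<in> ?V then C else 0) = int (card ?V) * C"
  proof -
    have "carrier A \<inter> ?V = ?V"
      by (auto simp: common_zeros_def)
    then show ?thesis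
      using fin by (simp add: sum.If_cases Int_def[symmetric])
  qed
  ultimately have "int p dvd int (card ?V) * C"
    by (metis cong_dvd_iff)
  moreover have "\<not> int p dvd C"
    unfolding C_def using g(4) p(1) by (auto simp: prime_dvd_prod_iff)
  ultimately have "int p dvd int (card ?V)"
    using p(1) prime_dvd_mult_iff by blast
  then show ?thesis
    by (simp only: int_dvd_int_iff)
qed simp

end
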